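(* Let $G$ be a finite group. If $|[G,G]| \le 3$, or $[G,G] \cong \mathbb{Z}_4$, then every connected Cayley digraph on $G$ has a hamiltonian path.
   Context: For a subset $S$ of a finite group $G$, the Cayley digraph $\overrightarrow{\mathrm{Cay}}(G;S)$ is the directed graph whose vertices are the elements of $G$, with a directed edge $g \to gs$ for every $g \in G$ and $s \in S$. It is connected if and only if $S$ generates $G$; a connected Cayley digraph on $G$ means $\overrightarrow{\mathrm{Cay}}(G;S)$ for some generating set $S$ of $G$. A hamiltonian path is a directed path that visits every vertex exactly once (a single vertex counts as a path). $[G,G]$ is the commutator subgroup of $G$, and $\mathbb{Z}_4$ is the cyclic group of order $4$. *)

theory Defs
  imports
    "HOL-Algebra.Generated_Groups"
    "HOL-Algebra.Elementary_Groups"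
    "Graph_Theory.Pair_Digraph"
    "Graph_Theory.Vertex_Walk"
begin

definition cayley_digraph :: "('a, 'b) monoid_scheme \<Rightarrow> 'a set \<Rightarrow> 'a pair_pre_digraph" where
  "cayley_digraph G S =
     \<lparr> pverts = carrier G,
       parcs = {(g, g \<otimes>\<^bsub>G\<^esub> s) | g s. g \<in> carrier G \<and> s \<in> S} \<rparr>"

lemma (in group) pair_fin_digraph_cayley_digraph:
  assumes "finite (carrier G)" and "S \<subseteq> carrier G"
  shows "pair_fin_digraph (cayley_digraph G S)"
proof
  have sub: "parcs (cayley_digraph G S) \<subseteq> carrier G \<times> carrier G"
    using assms(2) by (auto simp: cayley_digraph_def)
  show "fst e \<in> pverts (cayley_digraph G S)" "snd e \<in> pverts (cayley_digraph G S)"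
    if "e \<in> parcs (cayley_digraph G S)" for e
    using that assms(2) by (auto simp: cayley_digraph_def subset_iff)
  show "finite (pverts (cayley_digraph G S))"
    using assms(1) by (simp add: cayley_digraph_def)
  show "finite (parcs (cayley_digraph G S))"
    using finite_subset[OF sub] assms(1) by simp
qed

text \<open>
  A path is given by its nonempty list of vertices; \<^const>\<open>vpath\<close> demands that they be distinct
  and that consecutive ones be joined by an arc in the forward direction.
\<close>

definition hamiltonian_path :: "'v list \<Rightarrow> ('v, 'e) pre_digraph \<Rightarrow> bool" where
  "hamiltonian_path p D \<longleftrightarrow> vpath p D \<and> set p = verts D"

abbreviation commutator_subgroup :: "('a, 'b) monoid_scheme \<Rightarrow> 'a set" where
  "commutator_subgroup G \<equiv> derived G (carrier G)"

end

theory Submission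
  imports Defs "HOL-Algebra.Multiplicative_Group"
begin

text \<open>
  Only two features of \<open>C = [G, G]\<close> matter: the subgroups of \<open>C\<close> form a chain under inclusion, and
  every element of \<open>G\<close> either centralizes \<open>C\<close> or inverts every element of \<open>C\<close>. A cyclic group of
  order at most four has both, since it has at most one proper nontrivial subgroup and its only
  generators are some \<open>c\<close> and its inverse. The locale \<open>inverted_chain\<close> records the two features; they
  apply to the commutators of every subgroup of \<open>G\<close>, so induction on the order is possible.

  Because of the chain condition a single commutator \<open>[a, b]\<close> of two elements of \<open>S\<close> generates \<open>C\<close>
  (\<open>chain_has_generator\<close>, \<open>commutators_in_subgroup\<close>). The subgroup \<open>\<langle>a, b\<rangle>\<close> then contains all
  commutators, so it and everything above it is normal. A hamiltonian path of a normal subgroup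
  \<open>N\<close> followed by one further generator \<open>s\<close> can be repeated, and sweeps out the cosets of \<open>N\<close> in
  \<open>\<langle>N, s\<rangle>\<close> one after the other (\<open>path_on_extend\<close>). Hence it suffices to treat \<open>H = \<langle>a, b\<rangle>\<close>.

  For two generators put \<open>e = a\<^sup>-\<^sup>1b\<close> and \<open>x = b\<^sup>-\<^sup>1a\<^sup>-\<^sup>1ba\<close>. Then \<open>L = \<langle>e\<rangle>\<langle>x\<rangle>\<close> is normal in \<open>H\<close>, and
  \<open>H/L\<close> is cyclic of some order \<open>m\<close>, generated by the common coset of \<open>a\<close> and \<open>b\<close>.

  If \<open>m \<ge> 2\<close>, let \<open>v\<close> be a word of length \<open>m - 1\<close> in \<open>a, b\<close>. The products \<open>va\<close> and \<open>vb\<close> lie in \<open>L\<close>,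
  and if they generate \<open>L\<close>, then a hamiltonian path of \<open>L\<close> with these two steps becomes one of \<open>H\<close>
  when every step is spelled out letter by letter, because the letters of one step run through the
  \<open>m\<close> cosets of \<open>L\<close>. At least one of \<open>v = a\<^sup>m\<^sup>-\<^sup>1\<close> and \<open>v = a\<^sup>m\<^sup>-\<^sup>2b\<close> has this property: the two subgroups
  \<open>\<langle>va, vb\<rangle>\<close> contain \<open>e\<close>, so they are comparable (\<open>subgroups_above_comparable\<close>), and the larger one
  contains \<open>b\<^sup>-\<^sup>1eb = xe\<close>, hence \<open>x\<close>.

  If \<open>m = 1\<close>, then \<open>a\<close> is a power of \<open>e\<close> times an element \<open>c\<close> of \<open>\<langle>x\<rangle>\<close>. When \<open>a\<close> centralizes \<open>C\<close>,
  the powers of \<open>a\<close> and of \<open>c\<close> represent the same cosets of \<open>\<langle>e\<rangle>\<close>, so \<open>H = \<langle>e\<rangle>\<langle>a\<rangle>\<close>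
  (\<open>generate_pair_factorization\<close>), and repeating \<open>a, \<dots>, a, b\<close> with \<open>|a| - 1\<close> letters \<open>a\<close> runs through
  \<open>\<langle>a\<rangle>\<close>, \<open>e\<langle>a\<rangle>\<close>, \<open>e\<^sup>2\<langle>a\<rangle>\<close> and so on (\<open>path_on_factorization\<close>). The roles of \<open>a\<close> and \<open>b\<close> can be exchanged
  if \<open>b\<close> centralizes \<open>C\<close>. If both invert \<open>C\<close>, then \<open>e\<close> centralizes it, \<open>H\<close> is abelian and \<open>x = 1\<close>.
\<close>

section \<open>Directed paths through subsets of a finite group\<close>

locale finite_group = group G for G (structure) +
  assumes finite_carrier: "finite (carrier G)"
begin

lemma mult_inv_cancel_left:
  assumes "x \<in> carrier G" "y \<in> carrier G"
  shows "x \<otimes> (inv x \<otimes> y) = y" "inv x \<otimes> (x \<otimes> y) = y"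
  using assms by (simp_all flip: m_assoc)

lemmas word_simps = m_assoc inv_mult_group mult_inv_cancel_left

text \<open>
  Arcs \<open>g \<rightarrow> gs\<close> are preserved by left translation, so nothing is lost by starting at \<open>\<one>\<close>, and a
  path through a subgroup can be transported to each of its left cosets. The step set \<open>S\<close> is a
  parameter because the steps inside a proper subgroup may be longer words in the generators.
\<close>

definition path_on :: "'a set \<Rightarrow> 'a set \<Rightarrow> 'a list \<Rightarrow> bool" where
  "path_on S H p \<longleftrightarrow> p \<noteq> [] \<and> hd p = \<one> \<and> distinct p \<and> set p = H \<and>
     successively (\<lambda>x y. \<exists>s\<in>S. y = x \<otimes> s) p"

lemma path_on_mono: "path_on S H p \<Longrightarrow> S \<subseteq> T \<Longrightarrow> path_on T H p"
  unfolding path_on_def by (auto elim!: successively_mono)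

text \<open>
  Both ways of enlarging a path come from this gluing principle: the translates \<open>tp\<close> of one path
  \<open>p\<close> are traversed one after the other, and the jump from the end of \<open>tp\<close> to the start of \<open>t'p\<close> is
  a step \<open>s\<close> exactly when \<open>t' = t \<cdot> last p \<cdot> s\<close>. It is used with \<open>p\<close> running through a subgroup and
  \<open>ts\<close> through powers of a single element, and conversely with \<open>ts\<close> running through a subgroup and
  \<open>p\<close> through representatives of its cosets.
\<close>

lemma path_on_product:
  assumes p: "path_on S P p" and ts: "path_on ((\<otimes>) (last p) ` S) T ts"
    and sub: "S \<subseteq> carrier G" "P \<subseteq> carrier G" "T \<subseteq> carrier G"
    and inj: "inj_on (\<lambda>(t, h). t \<otimes> h) (T \<times> P)"
  shows "path_on S (T <#> P) (map (\<lambda>(t, h). t \<otimes> h) (List.product ts p))"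
proof -
  let ?f = "\<lambda>(t, h). t \<otimes> h"
  let ?R = "\<lambda>x y. \<exists>s\<in>S. y = x \<otimes> s"
  have pne: "p \<noteq> []" "hd p = \<one>" "set p = P" "distinct p" "successively ?R p"
    using p by (auto simp: path_on_def)
  have tne: "ts \<noteq> []" "hd ts = \<one>" "set ts = T" "distinct ts"
    "successively (\<lambda>x y. \<exists>s\<in>(\<otimes>) (last p) ` S. y = x \<otimes> s) ts"
    using ts by (auto simp: path_on_def)
  have lastP: "last p \<in> carrier G" using pne sub by auto
  have prod_eq: "map ?f (List.product us p) = concat (map (\<lambda>t. map ((\<otimes>) t) p) us)" for us
    by (induction us) auto
  have hdprod: "hd (map ?f (List.product (u # us) p)) = u" if "u \<in> carrier G" for u us
    using pne that by (cases p) auto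
  have block: "successively ?R (map ((\<otimes>) t) p)" if t: "t \<in> carrier G" for t
  proof -
    have "successively (\<lambda>x y. ?R (t \<otimes> x) (t \<otimes> y)) p"
      using pne(5)
    proof (rule successively_mono)
      fix x y assume "x \<in> set p" "y \<in> set p" "?R x y"
      then show "?R (t \<otimes> x) (t \<otimes> y)" using t sub pne by (auto simp: m_assoc subset_iff)
    qed
    then show ?thesis by (simp add: successively_map)
  qed
  have succ: "successively ?R (map ?f (List.product us p))"
    if "set us \<subseteq> carrier G" "successively (\<lambda>x y. \<exists>s\<in>(\<otimes>) (last p) ` S. y = x \<otimes> s) us" for us
    using that
  proof (induction us)
    case (Cons u us)
    show ?case
    proof (cases us)
      case Nil
      then show ?thesis using Cons.prems block[of u] by (simp add: comp_def)
    next
      case (Cons w ws)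
      have car: "u \<in> carrier G" "w \<in> carrier G" using Cons.prems Cons by auto
      have rest: "successively ?R (map ?f (List.product us p))"
        using Cons.IH Cons.prems Cons by simp
      obtain s where s: "s \<in> S" "w = u \<otimes> (last p \<otimes> s)"
        using Cons.prems Cons by auto
      have "last (map ((\<otimes>) u) p) = u \<otimes> last p" using pne by (simp add: last_map)
      moreover have "hd (map ?f (List.product us p)) = w" using hdprod[OF car(2)] Cons by simp
      moreover have "w = u \<otimes> last p \<otimes> s" using s car lastP sub by (auto simp: m_assoc)
      ultimately have "?R (last (map ((\<otimes>) u) p)) (hd (map ?f (List.product us p)))"
        using s by auto
      then show ?thesis
        using block[OF car(1)] rest
        by (simp add: successively_append_iff comp_def)
    qed
  qed simp
  have "distinct (map ?f (List.product ts p))"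
    using inj pne tne by (simp add: distinct_map distinct_product)
  moreover have "set (map ?f (List.product ts p)) = T <#> P"
    using pne tne by (auto simp: set_mult_def)
  moreover have "map ?f (List.product ts p) \<noteq> []" "hd (map ?f (List.product ts p)) = \<one>"
    using pne tne hdprod[of "hd ts" "tl ts"] by (cases ts; cases p; simp)+
  ultimately show ?thesis
    using succ[of ts] tne sub unfolding path_on_def by auto
qed

lemma last_product:
  "ts \<noteq> [] \<Longrightarrow> p \<noteq> [] \<Longrightarrow> last (map (\<lambda>(t, h). t \<otimes> h) (List.product ts p)) = last ts \<otimes> last p"
proof (induction ts rule: list_nonempty_induct)
  case (cons t ts)
  then have "List.product ts p \<noteq> []" by (cases ts; cases p) auto
  then show ?case using cons by simp
qed (simp add: last_map)

section \<open>Cosets by the powers of an element\<close>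

definition power_cosets :: "'a \<Rightarrow> 'a set \<Rightarrow> 'a set" where
  "power_cosets u N = range (\<lambda>j::nat. u [^] j) <#> N"

lemma power_cosets_iff: "x \<in> power_cosets u N \<longleftrightarrow> (\<exists>j::nat. \<exists>n\<in>N. x = u [^] j \<otimes> n)"
  by (auto simp: power_cosets_def set_mult_def)

text \<open>
  In a finite group inverses are natural powers, which is why closure conditions need to be checked
  for products and for natural exponents only.
\<close>

lemma power_pred_ord_eq_inv:
  assumes "x \<in> carrier G" shows "x [^] (ord x - 1) = inv x"
proof (rule inv_equality[symmetric])
  have "0 < ord x" using ord_ge_1[OF finite_carrier assms] by simp
  then have "x [^] (ord x - 1) \<otimes> x = x [^] ord x"
    by (metis Suc_diff_1 nat_pow_Suc)
  then show "x [^] (ord x - 1) \<otimes> x = \<one>" using assms by simp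
qed (use assms in auto)

lemma subgroup_powI: "subgroup N G \<Longrightarrow> x \<in> N \<Longrightarrow> x [^] (k::nat) \<in> N"
  by (induction k) (auto intro: subgroup.one_closed subgroup.m_closed)

lemma finite_subgroupI:
  assumes "H \<subseteq> carrier G" "\<one> \<in> H" "\<And>x y. x \<in> H \<Longrightarrow> y \<in> H \<Longrightarrow> x \<otimes> y \<in> H"
  shows "subgroup H G"
proof (rule subgroupI)
  fix x assume x: "x \<in> H"
  have "x [^] (k::nat) \<in> H" for k
    by (induction k) (use assms x in auto)
  then show "inv x \<in> H" using power_pred_ord_eq_inv x assms by (metis subsetD)
qed (use assms in auto)

lemma conj_power_closed:
  assumes N: "N \<subseteq> carrier G" and u: "u \<in> carrier G"
    and norm: "\<And>n. n \<in> N \<Longrightarrow> inv u \<otimes> n \<otimes> u \<in> N" and n: "n \<in> N"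
  shows "inv (u [^] (j::nat)) \<otimes> n \<otimes> u [^] j \<in> N"
proof (induction j)
  case 0
  then show ?case using n N by auto
next
  case (Suc j)
  have nc: "n \<in> carrier G" using n N by auto
  have "inv (u [^] Suc j) \<otimes> n \<otimes> u [^] Suc j = inv u \<otimes> (inv (u [^] j) \<otimes> n \<otimes> u [^] j) \<otimes> u"
    using u nc by (simp add: word_simps)
  then show ?case using norm[OF Suc] by simp
qed

text \<open>
  Conjugation by \<open>u\<close> is conjugation by a natural power of \<open>u\<^sup>-\<^sup>1\<close>, since \<open>u\<close> has finite order.
\<close>

lemma conj_inv_closed:
  assumes "N \<subseteq> carrier G" "u \<in> carrier G"
    "\<And>n. n \<in> N \<Longrightarrow> inv u \<otimes> n \<otimes> u \<in> N" "n \<in> N"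
  shows "u \<otimes> n \<otimes> inv u \<in> N"
  using conj_power_closed[OF assms, of "ord u - 1"] assms(2)
  by (simp add: power_pred_ord_eq_inv del: One_nat_def)

text \<open>
  Moving \<open>n\<close> past \<open>u\<^sup>j\<close> replaces it by a conjugate in \<open>N\<close>, so the products \<open>u\<^sup>in\<close> are closed under
  multiplication, which is enough in a finite group.
\<close>

lemma generate_insert_normalized:
  assumes N: "subgroup N G" and u: "u \<in> carrier G"
    and norm: "\<And>n. n \<in> N \<Longrightarrow> inv u \<otimes> n \<otimes> u \<in> N"
  shows "generate G (insert u N) = power_cosets u N"
proof
  have Nc: "N \<subseteq> carrier G" using N by (rule subgroup.subset)
  have mult: "x \<otimes> y \<in> power_cosets u N" if xy: "x \<in> power_cosets u N" "y \<in> power_cosets u N" for x y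
  proof -
    obtain i j :: nat and n n' where *: "x = u [^] i \<otimes> n" "y = u [^] j \<otimes> n'" "n \<in> N" "n' \<in> N"
      using xy by (auto simp: power_cosets_iff)
    then have c: "n \<in> carrier G" "n' \<in> carrier G" using Nc by auto
    have "x \<otimes> y = u [^] (i + j) \<otimes> ((inv (u [^] j) \<otimes> n \<otimes> u [^] j) \<otimes> n')"
      using * c u by (simp add: word_simps flip: nat_pow_mult)
    moreover have "(inv (u [^] j) \<otimes> n \<otimes> u [^] j) \<otimes> n' \<in> N"
      using conj_power_closed[OF Nc u norm] * N by (simp add: subgroup.m_closed)
    ultimately show ?thesis by (auto simp: power_cosets_iff)
  qed
  have "subgroup (power_cosets u N) G"
  proof (rule finite_subgroupI[OF _ _ mult])
    show "power_cosets u N \<subseteq> carrier G" using u subsetD[OF Nc] by (auto simp: power_cosets_iff)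
    have "\<one> = u [^] (0::nat) \<otimes> \<one>" by simp
    then show "\<one> \<in> power_cosets u N"
      unfolding power_cosets_iff using subgroup.one_closed[OF N] by blast
  qed
  moreover have "insert u N \<subseteq> power_cosets u N"
  proof -
    have "u = u [^] (1::nat) \<otimes> \<one>" using u by simp
    then have "u \<in> power_cosets u N"
      unfolding power_cosets_iff using subgroup.one_closed[OF N] by metis
    moreover have "n \<in> power_cosets u N" if "n \<in> N" for n
    proof -
      have "n = u [^] (0::nat) \<otimes> n" using that Nc by auto
      then show ?thesis unfolding power_cosets_iff using that by metis
    qed
    ultimately show ?thesis by blast
  qed
  ultimately show "generate G (insert u N) \<subseteq> power_cosets u N"
    by (simp add: generate_subgroup_incl)
  have sub: "subgroup (generate G (insert u N)) G"
    by (rule generate_is_subgroup) (use u Nc in auto)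
  show "power_cosets u N \<subseteq> generate G (insert u N)"
  proof
    fix x assume "x \<in> power_cosets u N"
    then obtain j :: nat and n where *: "x = u [^] j \<otimes> n" "n \<in> N" by (auto simp: power_cosets_iff)
    moreover from this have "u \<in> generate G (insert u N)" "n \<in> generate G (insert u N)"
      by (simp_all add: generate.incl)
    ultimately show "x \<in> generate G (insert u N)"
      by (simp add: subgroup.m_closed[OF sub] subgroup_powI[OF sub])
  qed
qed

lemma mem_generate_singleton:
  assumes "c \<in> carrier G"
  shows "x \<in> generate G {c} \<longleftrightarrow> (\<exists>k::nat. x = c [^] k)"
proof -
  have "generate G {c} = power_cosets c {\<one>}"
  proof -
    have "generate G {c} = generate G (insert c {\<one>})"
    proof
      show "generate G {c} \<subseteq> generate G (insert c {\<one>})" by (rule mono_generate) auto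
      show "generate G (insert c {\<one>}) \<subseteq> generate G {c}"
        by (rule generate_subgroup_incl)
          (use assms generate_is_subgroup[of "{c}"] in \<open>simp_all add: generate.one generate.incl\<close>)
    qed
    then show ?thesis
      using generate_insert_normalized[of "{\<one>}" c] assms triv_subgroup by auto
  qed
  then show ?thesis using assms by (auto simp: power_cosets_iff)
qed

text \<open>
  Division with remainder by the least \<open>m > 0\<close> with \<open>u\<^sup>m \<in> N\<close>. This covers products
  \<open>\<langle>u\<rangle>N\<close> that are not known to be subgroups, such as the factorization \<open>\<langle>e\<rangle>\<langle>a\<rangle>\<close> below.
\<close>

lemma power_cosets_transversal:
  assumes N: "subgroup N G" and u: "u \<in> carrier G"
  obtains m :: nat where "0 < m" "u [^] m \<in> N"
    "power_cosets u N = (\<lambda>j. u [^] j) ` {..<m} <#> N"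
    "\<And>i j n n'. i < m \<Longrightarrow> j < m \<Longrightarrow> n \<in> N \<Longrightarrow> n' \<in> N \<Longrightarrow> u [^] i \<otimes> n = u [^] j \<otimes> n' \<Longrightarrow> i = j"
proof -
  have Nc: "N \<subseteq> carrier G" using N by (rule subgroup.subset)
  define P where "P m \<longleftrightarrow> 0 < m \<and> u [^] m \<in> N" for m :: nat
  define m where "m = (LEAST m. P m)"
  have "P (ord u)"
    using ord_ge_1[OF finite_carrier u] u subgroup.one_closed[OF N] by (simp add: P_def)
  then have Pm: "P m" unfolding m_def by (rule LeastI)
  have least: "\<not> P k" if "k < m" for k using that unfolding m_def by (rule not_less_Least)
  have cov: "u [^] j \<otimes> n \<in> (\<lambda>j. u [^] j) ` {..<m} <#> N" if n: "n \<in> N" for j :: nat and n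
  proof -
    have "j = j mod m + m * (j div m)" by simp
    then have "u [^] j = u [^] (j mod m) \<otimes> (u [^] m) [^] (j div m)"
      using u by (metis nat_pow_mult nat_pow_pow)
    then have "u [^] j \<otimes> n = u [^] (j mod m) \<otimes> ((u [^] m) [^] (j div m) \<otimes> n)"
      using u n Nc by (simp add: m_assoc subset_iff)
    moreover have "(u [^] m) [^] (j div m) \<otimes> n \<in> N"
      using Pm n N by (auto simp: P_def intro!: subgroup.m_closed subgroup_powI)
    ultimately show ?thesis using Pm by (fastforce simp: set_mult_def P_def)
  qed
  have aux: "\<not> (i < j)" if "i < m" "j < m" "n \<in> N" "n' \<in> N" "u [^] i \<otimes> n = u [^] j \<otimes> n'"
    for i j n n'
  proof
    assume ij: "i < j"
    have c: "n \<in> carrier G" "n' \<in> carrier G" using that Nc by auto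
    have "u [^] j = u [^] i \<otimes> u [^] (j - i)" using ij u by (simp add: nat_pow_mult)
    then have "n = u [^] (j - i) \<otimes> n'" using that c u by (simp add: m_assoc)
    then have "u [^] (j - i) = n \<otimes> inv n'" using c u by (simp add: word_simps)
    then have "P (j - i)" using ij that N by (simp add: P_def subgroup.m_closed subgroup.m_inv_closed)
    then show False using least[of "j - i"] that by auto
  qed
  show thesis
  proof
    show "0 < m" "u [^] m \<in> N" using Pm by (auto simp: P_def)
    show "power_cosets u N = (\<lambda>j. u [^] j) ` {..<m} <#> N"
    proof
      show "power_cosets u N \<subseteq> (\<lambda>j. u [^] j) ` {..<m} <#> N"
        using cov by (auto simp: power_cosets_iff)
      show "(\<lambda>j. u [^] j) ` {..<m} <#> N \<subseteq> power_cosets u N"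
        unfolding power_cosets_def by (rule mono_set_mult) auto
    qed
    show "i = j" if "i < m" "j < m" "n \<in> N" "n' \<in> N" "u [^] i \<otimes> n = u [^] j \<otimes> n'" for i j n n'
      using aux[OF that] aux[OF that(2,1,4,3) that(5)[symmetric]] by simp
  qed
qed

text \<open>
  A path through \<open>N\<close> followed by \<open>s\<close> leads from \<open>\<one>\<close> to \<open>u = last p \<cdot> s\<close>, so its repetitions traverse
  the cosets \<open>N, uN, u\<^sup>2N, \<dots>\<close> until \<open>u\<^sup>m \<in> N\<close>. The endpoint is recorded because the next extension
  depends on it.
\<close>

lemma path_on_power_cosets:
  assumes N: "subgroup N G" and p: "path_on S N p" and s: "s \<in> S" and S: "S \<subseteq> carrier G"
  obtains q k where "path_on S (power_cosets (last p \<otimes> s) N) q"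
    "last q = (last p \<otimes> s) [^] (k::nat) \<otimes> last p" "(last p \<otimes> s) [^] Suc k \<in> N"
proof -
  let ?u = "last p \<otimes> s"
  have Nc: "N \<subseteq> carrier G" using N by (rule subgroup.subset)
  have "last p \<in> N" using p by (auto simp: path_on_def)
  then have u: "?u \<in> carrier G" using Nc s S by auto
  obtain m :: nat where m: "0 < m" "?u [^] m \<in> N"
    "power_cosets ?u N = (\<lambda>j. ?u [^] j) ` {..<m} <#> N"
    "\<And>i j n n'. i < m \<Longrightarrow> j < m \<Longrightarrow> n \<in> N \<Longrightarrow> n' \<in> N \<Longrightarrow> ?u [^] i \<otimes> n = ?u [^] j \<otimes> n' \<Longrightarrow> i = j"
    using power_cosets_transversal[OF N u] by metis
  let ?ts = "map (\<lambda>j. ?u [^] j) [0..<m]"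
  have inj: "inj_on (\<lambda>(t, h). t \<otimes> h) ((\<lambda>j. ?u [^] j) ` {..<m} \<times> N)"
  proof (rule inj_onI, clarsimp)
    fix i j n n' assume *: "n \<in> N" "n' \<in> N" "i < m" "j < m" "?u [^] i \<otimes> n = ?u [^] j \<otimes> n'"
    then have "i = j" using m(4) by blast
    then show "?u [^] i = ?u [^] j \<and> n = n'" using * u Nc by (auto simp: subset_iff)
  qed
  have "path_on ((\<otimes>) (last p) ` S) ((\<lambda>j. ?u [^] j) ` {..<m}) ?ts"
    unfolding path_on_def
  proof (intro conjI)
    show "distinct ?ts"
      unfolding distinct_map
    proof
      show "inj_on (\<lambda>j. ?u [^] j) (set [0..<m])"
        using m(4)[of _ _ \<one> \<one>] subgroup.one_closed[OF N] by (auto simp: inj_on_def)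
    qed simp
    show "successively (\<lambda>x y. \<exists>s\<in>(\<otimes>) (last p) ` S. y = x \<otimes> s) ?ts"
      using s by (auto simp: successively_conv_nth)
  qed (use m in \<open>auto simp: hd_map atLeast0LessThan\<close>)
  from path_on_product[OF p this S Nc _ inj]
  have path: "path_on S (power_cosets ?u N) (map (\<lambda>(t, h). t \<otimes> h) (List.product ?ts p))"
    using u m(3) by auto
  have "last (map (\<lambda>(t, h). t \<otimes> h) (List.product ?ts p)) = last ?ts \<otimes> last p"
    by (rule last_product) (use m p in \<open>auto simp: path_on_def\<close>)
  also have "last ?ts = ?u [^] (m - 1)" using m by (simp add: last_map)
  finally show thesis using that[OF path, of "m - 1"] m by simp
qed

text \<open>
  That the path stops at \<open>a\<^sup>-\<^sup>1\<close> means that a following step \<open>b\<close> leads to \<open>a\<^sup>-\<^sup>1b\<close>.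
\<close>

lemma path_on_cyclic:
  assumes a: "a \<in> carrier G"
  obtains q where "path_on {a} (generate G {a}) q" "last q = inv a"
proof -
  have "path_on {a} {\<one>} [\<one>]" by (simp add: path_on_def)
  from path_on_power_cosets[OF triv_subgroup this, of a] a
  obtain q k where q: "path_on {a} (power_cosets a {\<one>}) q"
    "last q = a [^] (k::nat)" "a [^] Suc k = \<one>" by auto
  have "power_cosets a {\<one>} = generate G {a}"
    using a by (auto simp: power_cosets_iff mem_generate_singleton)
  moreover have "last q = inv a"
    using q a by (metis inv_equality nat_pow_Suc nat_pow_closed)
  ultimately show thesis using that q by metis
qed

text \<open>
  The word \<open>a \<dots> a b\<close> that first exhausts \<open>\<langle>a\<rangle>\<close> has the value \<open>a\<^sup>-\<^sup>1b\<close>, so its repetitions visit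
  exactly the left cosets of \<open>\<langle>a\<rangle>\<close> by powers of \<open>a\<^sup>-\<^sup>1b\<close>.
\<close>

lemma path_on_factorization:
  assumes a: "a \<in> carrier G" and b: "b \<in> carrier G"
    and fact: "generate G {a, b} \<subseteq> power_cosets (inv a \<otimes> b) (generate G {a})"
  shows "\<exists>p. path_on {a, b} (generate G {a, b}) p"
proof -
  obtain q where q: "path_on {a} (generate G {a}) q" "last q = inv a"
    using path_on_cyclic[OF a] .
  have A: "subgroup (generate G {a}) G" using a by (intro generate_is_subgroup) auto
  have H: "subgroup (generate G {a, b}) G" using a b by (intro generate_is_subgroup) auto
  have "path_on {a, b} (generate G {a}) q" by (rule path_on_mono[OF q(1)]) auto
  from path_on_power_cosets[OF A this, of b] a b q(2)
  obtain r where r: "path_on {a, b} (power_cosets (inv a \<otimes> b) (generate G {a})) r"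
    by auto
  have mem: "a \<in> generate G {a, b}" "b \<in> generate G {a, b}" by (auto intro: generate.incl)
  have "generate G {a} \<subseteq> generate G {a, b}" by (rule mono_generate) auto
  moreover have "inv a \<otimes> b \<in> generate G {a, b}"
    using H mem by (simp add: subgroup.m_closed subgroup.m_inv_closed)
  ultimately have "power_cosets (inv a \<otimes> b) (generate G {a}) \<subseteq> generate G {a, b}"
    unfolding subset_iff power_cosets_iff
    by (metis subgroup.m_closed[OF H] subgroup_powI[OF H])
  then show ?thesis using r fact by (metis subset_antisym)
qed

end

section \<open>Commutators in a chain on which the group acts by inversion\<close>

text \<open>
  The chain condition is stated for cyclic subgroups; it makes any two subgroups \<open>A, B\<close> of \<open>C\<close>
  comparable, since elements of \<open>A - B\<close> and \<open>B - A\<close> would generate incomparable ones. All subgroups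
  of \<open>C\<close> are normal in \<open>G\<close> because conjugation fixes or inverts their elements.
\<close>

locale inverted_chain = finite_group +
  fixes C :: "'a set"
  assumes subgroup_C: "subgroup C G"
    and commutator_in_C:
      "\<And>x y. x \<in> carrier G \<Longrightarrow> y \<in> carrier G \<Longrightarrow> x \<otimes> y \<otimes> inv x \<otimes> inv y \<in> C"
    and chain: "\<And>x y. x \<in> C \<Longrightarrow> y \<in> C \<Longrightarrow> x \<in> generate G {y} \<or> y \<in> generate G {x}"
    and action: "\<And>g. g \<in> carrier G \<Longrightarrow>
      (\<forall>x\<in>C. inv g \<otimes> x \<otimes> g = x) \<or> (\<forall>x\<in>C. inv g \<otimes> x \<otimes> g = inv x)"
begin

lemma C_carrier: "x \<in> C \<Longrightarrow> x \<in> carrier G"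
  using subgroup.subset[OF subgroup_C] by auto

lemma conj_closed:
  assumes "subgroup K G" "K \<subseteq> C" "g \<in> carrier G" "k \<in> K"
  shows "inv g \<otimes> k \<otimes> g \<in> K"
  using action[OF assms(3)] assms by (metis subgroup.m_inv_closed subsetD)

lemma generate_singleton_subset:
  assumes "subgroup H G" "x \<in> H" shows "generate G {x} \<subseteq> H"
  by (rule generate_subgroup_incl) (use assms in auto)

text \<open>
  Modular law: a subgroup between \<open>\<langle>e\<rangle>\<close> and \<open>\<langle>e\<rangle>Z\<close> is determined by its intersection with \<open>Z\<close>, and
  these intersections lie in the chain \<open>C\<close>.
\<close>

lemma subgroups_above_comparable:
  assumes K: "subgroup K G" "subgroup K' G" and e: "e \<in> K" "e \<in> K'"
    and Z: "Z \<subseteq> C" "K \<subseteq> power_cosets e Z" "K' \<subseteq> power_cosets e Z"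
  shows "K \<subseteq> K' \<or> K' \<subseteq> K"
proof (rule ccontr)
  assume "\<not> ?thesis"
  then obtain k k' where kk: "k \<in> K" "k \<notin> K'" "k' \<in> K'" "k' \<notin> K" by auto
  have ec: "e \<in> carrier G" using e K subgroup.subset by blast
  obtain i j :: nat and z z' where *: "k = e [^] i \<otimes> z" "k' = e [^] j \<otimes> z'" "z \<in> Z" "z' \<in> Z"
    using kk Z unfolding power_cosets_iff subset_iff by metis
  have zc: "z \<in> carrier G" "z' \<in> carrier G" using * Z C_carrier by auto
  have "z = inv (e [^] i) \<otimes> k" "z' = inv (e [^] j) \<otimes> k'"
    using * ec zc by (simp_all add: mult_inv_cancel_left)
  then have "z \<in> K" "z' \<in> K'"
    using kk K e by (simp_all add: subgroup.m_closed subgroup.m_inv_closed subgroup_powI)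
  moreover have "z \<notin> K'" "z' \<notin> K"
    using kk * K e by (auto simp: subgroup.m_closed subgroup_powI)
  ultimately show False
    using chain[of z z'] * Z generate_singleton_subset K by blast
qed

text \<open>
  The subgroup \<open>\<langle>a, b\<rangle>\<close> lies in \<open>\<langle>e\<rangle>\<langle>c\<rangle>\<close> for \<open>e = a\<^sup>-\<^sup>1b\<close>. As \<open>a\<close> commutes with \<open>c\<close>, so does
  \<open>e\<^sup>i = ac\<^sup>-\<^sup>1\<close>, whence \<open>a\<^sup>k = e\<^sup>i\<^sup>kc\<^sup>k\<close> and each \<open>c\<^sup>k\<close> can be traded for \<open>a\<^sup>k\<close> at the cost of a power of \<open>e\<close>.
\<close>

lemma generate_pair_factorization:
  assumes a: "a \<in> carrier G" and b: "b \<in> carrier G" and c: "c \<in> C"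
    and a_eq: "a = (inv a \<otimes> b) [^] (i::nat) \<otimes> c" and comm: "a \<otimes> c = c \<otimes> a"
  shows "generate G {a, b} \<subseteq> power_cosets (inv a \<otimes> b) (generate G {a})"
proof -
  define e where "e = inv a \<otimes> b"
  have a_eq': "a = e [^] i \<otimes> c" using a_eq unfolding e_def .
  have e: "e \<in> carrier G" using a b by (simp add: e_def)
  have cc: "c \<in> carrier G" using c by (rule C_carrier)
  have Zsub: "subgroup (generate G {c}) G" using cc by (intro generate_is_subgroup) auto
  have norm: "inv e \<otimes> n \<otimes> e \<in> generate G {c}" if "n \<in> generate G {c}" for n
    using conj_closed[OF Zsub generate_singleton_subset[OF subgroup_C c] e that] .
  have gen: "generate G (insert e (generate G {c})) = power_cosets e (generate G {c})"
    by (rule generate_insert_normalized[OF Zsub e norm])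
  have sub: "subgroup (power_cosets e (generate G {c})) G"
    unfolding gen[symmetric]
    by (rule generate_is_subgroup) (use e subgroup.subset[OF Zsub] in auto)
  have emem: "e \<in> power_cosets e (generate G {c})"
    unfolding gen[symmetric] by (rule generate.incl) auto
  have amem: "a \<in> power_cosets e (generate G {c})"
    using a_eq' generate.incl[of c "{c}"] unfolding power_cosets_iff by blast
  have "b = a \<otimes> e" using a b unfolding e_def by (simp add: mult_inv_cancel_left)
  then have bmem: "b \<in> power_cosets e (generate G {c})"
    using subgroup.m_closed[OF sub amem emem] by simp
  have "generate G {a, b} \<subseteq> power_cosets e (generate G {c})"
    by (rule generate_subgroup_incl[OF _ sub]) (use amem bmem in auto)
  also have "\<dots> \<subseteq> power_cosets e (generate G {a})"
  proof
    fix x assume "x \<in> power_cosets e (generate G {c})"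
    then obtain j k :: nat where x: "x = e [^] j \<otimes> c [^] k"
      using cc by (auto simp: power_cosets_iff mem_generate_singleton)
    have ei: "e [^] i = a \<otimes> inv c"
      using inv_solve_right[of "e [^] i" a c] a_eq' a cc e by auto
    have comm_e: "c \<otimes> e [^] i = e [^] i \<otimes> c"
    proof -
      have "c \<otimes> (a \<otimes> inv c) = (a \<otimes> c) \<otimes> inv c" using a cc comm by (simp flip: m_assoc)
      also have "\<dots> = (a \<otimes> inv c) \<otimes> c" using a cc by (simp add: m_assoc)
      finally show ?thesis unfolding ei .
    qed
    have "a [^] k = (e [^] i \<otimes> c) [^] k" using a_eq' by simp
    also have "\<dots> = (e [^] i) [^] k \<otimes> c [^] k"
      by (rule pow_mult_distrib) (use comm_e cc e in auto)
    finally have "c [^] k = inv (e [^] (i * k)) \<otimes> a [^] k"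
      using e cc by (simp add: nat_pow_pow mult_inv_cancel_left)
    then have "x = (e [^] j \<otimes> inv (e [^] (i * k))) \<otimes> a [^] k"
      using x e a by (simp add: m_assoc)
    moreover have "e [^] j \<otimes> inv (e [^] (i * k)) \<in> generate G {e}"
    proof -
      have "subgroup (generate G {e}) G" using e by (intro generate_is_subgroup) auto
      moreover have "e \<in> generate G {e}" by (rule generate.incl) auto
      ultimately show ?thesis
        by (simp add: subgroup.m_closed subgroup.m_inv_closed subgroup_powI)
    qed
    then obtain l :: nat where "e [^] j \<otimes> inv (e [^] (i * k)) = e [^] l"
      using e by (auto simp: mem_generate_singleton)
    moreover have "a [^] k \<in> generate G {a}" using a by (auto simp: mem_generate_singleton)
    ultimately show "x \<in> power_cosets e (generate G {a})" unfolding power_cosets_iff by metis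
  qed
  finally show ?thesis by (simp add: e_def)
qed

lemma conj_generate:
  assumes L: "subgroup L G" and g: "g \<in> carrier G" and X: "X \<subseteq> carrier G"
    and conj: "\<And>x. x \<in> X \<Longrightarrow> inv g \<otimes> x \<otimes> g \<in> L" and n: "n \<in> generate G X"
  shows "inv g \<otimes> n \<otimes> g \<in> L"
  using n
proof (induction n rule: generate.induct)
  case one
  then show ?case using g subgroup.one_closed[OF L] by simp
next
  case (incl h)
  then show ?case by (rule conj)
next
  case (inv h)
  then have "inv (inv g \<otimes> h \<otimes> g) \<in> L" using conj L by (simp add: subgroup.m_inv_closed)
  moreover have "inv (inv g \<otimes> h \<otimes> g) = inv g \<otimes> inv h \<otimes> g"
    using inv g X by (auto simp: word_simps subset_iff)
  ultimately show ?case by simp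
next
  case (eng h k)
  have hk: "h \<in> carrier G" "k \<in> carrier G" using eng X generate_in_carrier by auto
  have "inv g \<otimes> (h \<otimes> k) \<otimes> g = (inv g \<otimes> h \<otimes> g) \<otimes> (inv g \<otimes> k \<otimes> g)"
    using hk g by (simp add: word_simps)
  then show ?case using eng L by (simp add: subgroup.m_closed)
qed

text \<open>
  Induction on the order of \<open>\<langle>a, b\<rangle>\<close>. Writing \<open>L = \<langle>e\<rangle>\<langle>x\<rangle>\<close> as above, either \<open>a \<in> L\<close> and \<open>\<langle>a, b\<rangle>\<close>
  factors as \<open>\<langle>e\<rangle>\<langle>a\<rangle>\<close> or as \<open>\<langle>e\<rangle>\<langle>b\<rangle>\<close>, or \<open>L\<close> is a proper subgroup generated by two words of the
  form \<open>va, vb\<close> and its path can be refined.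
\<close>

lemma path_on_generate_pair:
  assumes "a \<in> carrier G" "b \<in> carrier G"
  shows "\<exists>p. path_on {a, b} (generate G {a, b}) p"
  using assms
proof (induction "card (generate G {a, b})" arbitrary: a b rule: less_induct)
  case less
  note a = less.prems(1) and b = less.prems(2)
  define e where "e = inv a \<otimes> b"
  define x where "x = inv b \<otimes> inv a \<otimes> b \<otimes> a"
  define Z where "Z = generate G {x}"
  define L where "L = power_cosets e Z"
  define H where "H = generate G {a, b}"
  have e: "e \<in> carrier G" and x: "x \<in> carrier G" using a b by (simp_all add: e_def x_def)
  have b_eq: "b = a \<otimes> e" using a b unfolding e_def by (simp add: mult_inv_cancel_left)
  have xC: "x \<in> C" using commutator_in_C[of "inv b" "inv a"] a b by (simp add: x_def)
  have Zsub: "subgroup Z G" unfolding Z_def using x by (intro generate_is_subgroup) auto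
  have ZC: "Z \<subseteq> C" unfolding Z_def by (rule generate_singleton_subset[OF subgroup_C xC])
  have xZ: "x \<in> Z" unfolding Z_def by (rule generate.incl) simp
  have Lgen: "L = generate G (insert e Z)"
    unfolding L_def using generate_insert_normalized[OF Zsub e conj_closed[OF Zsub ZC e]] by simp
  have Zc: "Z \<subseteq> carrier G" using subgroup.subset[OF Zsub] .
  have Lsub: "subgroup L G" unfolding Lgen by (rule generate_is_subgroup) (use e Zc in auto)
  have Lc: "L \<subseteq> carrier G" using subgroup.subset[OF Lsub] .
  have eL: "e \<in> L" and ZL: "Z \<subseteq> L" unfolding Lgen by (auto intro: generate.incl)
  have Hsub: "subgroup H G" unfolding H_def using a b by (intro generate_is_subgroup) auto
  have abH: "a \<in> H" "b \<in> H" unfolding H_def by (auto intro: generate.incl)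
  have eH: "e \<in> H" "x \<in> H"
    unfolding e_def x_def using abH Hsub
    by (simp_all add: subgroup.m_closed subgroup.m_inv_closed)
  have LH: "L \<subseteq> H"
    unfolding Lgen
    by (rule generate_subgroup_incl[OF _ Hsub])
      (use eH generate_singleton_subset[OF Hsub, of x] in \<open>auto simp: Z_def\<close>)
  have conj_a: "inv a \<otimes> n \<otimes> a \<in> L" if "n \<in> L" for n
  proof (rule conj_generate[OF Lsub a])
    show "n \<in> generate G (insert e Z)" using that by (simp add: Lgen)
    show "inv a \<otimes> y \<otimes> a \<in> L" if "y \<in> insert e Z" for y
    proof (cases "y = e")
      case True
      have "inv a \<otimes> e \<otimes> a = e \<otimes> x" unfolding e_def x_def using a b by (simp add: word_simps)
      then show ?thesis using True eL ZL xZ Lsub by (auto intro: subgroup.m_closed)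
    next
      case False
      then show ?thesis using that conj_closed[OF Zsub ZC a] ZL by auto
    qed
  qed (use e Zc in auto)
  have H_eq: "H = power_cosets a L"
  proof -
    have gen: "generate G (insert a L) = power_cosets a L"
      by (rule generate_insert_normalized[OF Lsub a conj_a])
    have sub: "subgroup (generate G (insert a L)) G"
      by (rule generate_is_subgroup) (use a Lc in auto)
    have mem: "a \<in> generate G (insert a L)" "e \<in> generate G (insert a L)"
      using eL by (auto intro: generate.incl)
    then have "b \<in> generate G (insert a L)"
      unfolding b_eq by (rule subgroup.m_closed[OF sub])
    then have "H \<subseteq> generate G (insert a L)"
      unfolding H_def using mem by (intro generate_subgroup_incl[OF _ sub]) auto
    moreover have "generate G (insert a L) \<subseteq> H"
      using abH LH by (intro generate_subgroup_incl[OF _ Hsub]) auto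
    ultimately show ?thesis using gen by simp
  qed
  obtain m :: nat where m: "0 < m" "a [^] m \<in> L"
    "power_cosets a L = (\<lambda>j. a [^] j) ` {..<m} <#> L"
    "\<And>i j n n'. i < m \<Longrightarrow> j < m \<Longrightarrow> n \<in> L \<Longrightarrow> n' \<in> L \<Longrightarrow> a [^] i \<otimes> n = a [^] j \<otimes> n' \<Longrightarrow> i = j"
    using power_cosets_transversal[OF Lsub a] by metis
  show ?case
  proof (cases "m = 1")
    case True
    then have "a \<in> L" using m(2) a by simp
    then obtain i :: nat and z where az: "a = e [^] i \<otimes> z" "z \<in> Z"
      by (auto simp: L_def power_cosets_iff)
    have zC: "z \<in> C" using az ZC by auto
    have zc: "z \<in> carrier G" using zC C_carrier by auto
    consider (centralA) "\<forall>y\<in>C. inv a \<otimes> y \<otimes> a = y" | (centralB) "\<forall>y\<in>C. inv b \<otimes> y \<otimes> b = y"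
      | (inverting) "\<forall>y\<in>C. inv a \<otimes> y \<otimes> a = inv y" "\<forall>y\<in>C. inv b \<otimes> y \<otimes> b = inv y"
      using action[OF a] action[OF b] by blast
    then show ?thesis
    proof cases
      case centralA
      have "a \<otimes> (inv a \<otimes> z \<otimes> a) = z \<otimes> a"
        using less.prems zc by (simp add: word_simps)
      then have "a \<otimes> z = z \<otimes> a" using centralA zC by simp
      then show ?thesis
        using path_on_factorization[OF less.prems generate_pair_factorization[OF less.prems zC]]
          az(1) unfolding e_def by blast
    next
      case centralB
      \<comment> \<open>With \<open>a\<close> and \<open>b\<close> exchanged, \<open>e\<close> becomes its inverse, of which \<open>e\<^sup>i\<^sup>+\<^sup>1\<close> is a power too.\<close>
      define z' where "z' = inv e \<otimes> z \<otimes> e"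
      have z': "z' \<in> C" unfolding z'_def
        using conj_closed[OF subgroup_C subset_refl e zC] .
      have z'c: "z' \<in> carrier G" using z' C_carrier by auto
      have "b = e [^] Suc i \<otimes> z'"
      proof -
        have "b = (e [^] i \<otimes> z) \<otimes> e" using b_eq az(1) by simp
        also have "\<dots> = e [^] Suc i \<otimes> z'" unfolding z'_def using e zc by (simp add: word_simps)
        finally show ?thesis .
      qed
      moreover obtain k :: nat where "e [^] Suc i = (inv b \<otimes> a) [^] k"
      proof -
        have sub: "subgroup (generate G {inv e}) G" using e by (intro generate_is_subgroup) auto
        have "inv (inv e) \<in> generate G {inv e}" by (rule generate.inv) simp
        then have "e [^] Suc i \<in> generate G {inv e}"
          using e by (intro subgroup_powI[OF sub]) simp
        then obtain k :: nat where "e [^] Suc i = inv e [^] k"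
          using e by (auto simp: mem_generate_singleton simp del: nat_pow_Suc)
        moreover have "inv e = inv b \<otimes> a" unfolding e_def using less.prems by (simp add: word_simps)
        ultimately show thesis using that by simp
      qed
      ultimately have beq: "b = (inv b \<otimes> a) [^] k \<otimes> z'" by simp
      have "b \<otimes> (inv b \<otimes> z' \<otimes> b) = z' \<otimes> b"
        using less.prems z'c by (simp add: word_simps)
      then have "b \<otimes> z' = z' \<otimes> b" using centralB z' by simp
      then show ?thesis
        using path_on_factorization[OF less.prems(2,1)
            generate_pair_factorization[OF less.prems(2,1) z' beq]]
        by (simp add: insert_commute)
    next
      case inverting
      have "inv e \<otimes> z \<otimes> e = z"
      proof -
        have iz: "inv z \<in> C" using zC subgroup_C by (simp add: subgroup.m_inv_closed)
        have "inv a \<otimes> inv z \<otimes> a = z" using inverting(1) iz zc by simp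
        then have "a \<otimes> z \<otimes> inv a = a \<otimes> (inv a \<otimes> inv z \<otimes> a) \<otimes> inv a" by simp
        also have "\<dots> = inv z" using a zc by (simp add: word_simps)
        finally have 1: "a \<otimes> z \<otimes> inv a = inv z" .
        have "inv e \<otimes> z \<otimes> e = inv b \<otimes> (a \<otimes> z \<otimes> inv a) \<otimes> b"
          unfolding e_def using a b zc by (simp add: word_simps)
        also have "\<dots> = z" unfolding 1 using inverting(2) iz zc by simp
        finally show ?thesis .
      qed
      moreover have "e \<otimes> (inv e \<otimes> z \<otimes> e) = z \<otimes> e" using e zc by (simp add: word_simps)
      ultimately have ez: "e \<otimes> z = z \<otimes> e" by simp
      have ae: "a \<otimes> e = e \<otimes> a"
      proof -
        have "a \<otimes> e = (e [^] i \<otimes> z) \<otimes> e" using az(1) by simp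
        also have "\<dots> = (e [^] i \<otimes> e) \<otimes> z" using e zc ez by (simp add: m_assoc)
        also have "e [^] i \<otimes> e = e \<otimes> e [^] i"
          using e by (metis nat_pow_Suc nat_pow_Suc2)
        also have "e \<otimes> e [^] i \<otimes> z = e \<otimes> a" using az(1) e zc by (simp add: m_assoc)
        finally show ?thesis .
      qed
      have "b \<otimes> a = a \<otimes> b" unfolding b_eq using a e by (simp add: m_assoc flip: ae)
      then have "x = inv b \<otimes> inv a \<otimes> (a \<otimes> b)" unfolding x_def using a b by (simp add: m_assoc)
      also have "\<dots> = \<one>" using a b by (simp add: word_simps)
      finally have "z = \<one>" using az(2) by (auto simp: Z_def mem_generate_singleton)
      then have "a \<otimes> z = z \<otimes> a" using a by simp
      then show ?thesis
        using path_on_factorization[OF less.prems generate_pair_factorization[OF less.prems zC]]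
          az(1) unfolding e_def by blast
    qed
  next
    case False
    with m(1) obtain k where k: "m = Suc (Suc k)" by (metis One_nat_def gr0_implies_Suc old.nat.exhaust)
    \<comment> \<open>The two candidates for \<open>v\<close> are \<open>a\<^sup>m\<^sup>-\<^sup>1\<close> and \<open>a\<^sup>m\<^sup>-\<^sup>2b\<close>, where \<open>k = m - 2\<close>.\<close>
    define K where "K v = generate G {v \<otimes> a, v \<otimes> b}" for v
    have vL: "v \<otimes> a \<in> L \<and> v \<otimes> b \<in> L \<and> v \<in> carrier G \<and>
        (\<exists>l\<in>L. v = a [^] Suc k \<otimes> l) \<and> (\<exists>s\<in>{a, b}. v = a [^] k \<otimes> s)"
      if "v \<in> {a [^] Suc k, a [^] k \<otimes> b}" for v
    proof -
      obtain l where l: "l = \<one> \<or> l = e" "v = a [^] Suc k \<otimes> l"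
      proof -
        note v_cases = \<open>v \<in> {a [^] Suc k, a [^] k \<otimes> b}\<close>
        have "v = a [^] Suc k \<otimes> \<one> \<or> v = a [^] Suc k \<otimes> e"
          using v_cases a e by (auto simp: b_eq m_assoc)
        then show thesis using that by blast
      qed
      then have lc: "l \<in> carrier G" and lL: "l \<in> L" using e eL subgroup.one_closed[OF Lsub] by auto
      have "v \<otimes> a = a [^] m \<otimes> (inv a \<otimes> l \<otimes> a)"
        using l(2) a lc by (simp add: k word_simps)
      then have "v \<otimes> a \<in> L" using m(2) conj_a[OF lL] Lsub by (simp add: subgroup.m_closed)
      moreover have "v \<in> carrier G" using l a lc by simp
      moreover have "v \<otimes> b = (v \<otimes> a) \<otimes> e" using calculation a e by (simp add: b_eq m_assoc)
      ultimately show ?thesis using that l lL eL Lsub by (auto simp: subgroup.m_closed)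
    qed
    have Ksub: "subgroup (K v) G" "K v \<subseteq> L" "e \<in> K v" "v \<otimes> b \<in> K v"
      if "v \<in> {a [^] Suc k, a [^] k \<otimes> b}" for v
    proof -
      note v = vL[OF that]
      show sub: "subgroup (K v) G" unfolding K_def
        by (rule generate_is_subgroup) (use v a b in auto)
      show "K v \<subseteq> L" unfolding K_def
        by (rule generate_subgroup_incl[OF _ Lsub]) (use v in auto)
      have mem: "v \<otimes> a \<in> K v" "v \<otimes> b \<in> K v" unfolding K_def by (auto intro: generate.incl)
      then show "v \<otimes> b \<in> K v" by simp
      have "inv (v \<otimes> a) \<otimes> (v \<otimes> b) \<in> K v"
        using mem sub by (simp add: subgroup.m_closed subgroup.m_inv_closed)
      moreover have "inv (v \<otimes> a) \<otimes> (v \<otimes> b) = e"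
        unfolding e_def using v a b by (simp add: word_simps)
      ultimately show "e \<in> K v" by simp
    qed
    obtain v where v: "v \<in> {a [^] Suc k, a [^] k \<otimes> b}"
      "K (a [^] Suc k) \<subseteq> K v" "K (a [^] k \<otimes> b) \<subseteq> K v"
    proof -
      have "K (a [^] Suc k) \<subseteq> K (a [^] k \<otimes> b) \<or> K (a [^] k \<otimes> b) \<subseteq> K (a [^] Suc k)"
        by (rule subgroups_above_comparable[of _ _ e Z]) (use Ksub ZC in \<open>auto simp flip: L_def\<close>)
      then show thesis using that by blast
    qed
    note vv = vL[OF v(1)]
    have KL: "K v = L"
    proof
      show "K v \<subseteq> L" using Ksub v by auto
      have 1: "a [^] Suc k \<otimes> b \<in> K v" "a [^] k \<otimes> b \<otimes> b \<in> K v"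
        using Ksub(4)[of "a [^] Suc k"] Ksub(4)[of "a [^] k \<otimes> b"] v(2,3) by blast+
      \<comment> \<open>The quotient of the two words is \<open>b\<^sup>-\<^sup>1eb = xe\<close>.\<close>
      have "inv (a [^] Suc k \<otimes> b) \<otimes> (a [^] k \<otimes> b \<otimes> b) \<otimes> inv e \<in> K v"
        using 1 Ksub(1,3)[OF v(1)] by (simp add: subgroup.m_closed subgroup.m_inv_closed)
      moreover have "inv (a [^] Suc k \<otimes> b) \<otimes> (a [^] k \<otimes> b \<otimes> b) \<otimes> inv e = x"
        unfolding e_def x_def using a b by (simp add: word_simps)
      ultimately have "x \<in> K v" by simp
      then have "Z \<subseteq> K v" unfolding Z_def using generate_singleton_subset Ksub(1) v(1) by blast
      then show "L \<subseteq> K v" unfolding Lgen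
        using Ksub(1,3)[OF v(1)] by (intro generate_subgroup_incl) auto
    qed
    have "a \<notin> L"
      using m(4)[of 0 1 a \<one>] subgroup.one_closed[OF Lsub] a k by auto
    then have "L \<subset> H" using LH abH by auto
    moreover have "finite H" using finite_subset[OF subgroup.subset[OF Hsub] finite_carrier] .
    ultimately have "card (generate G {v \<otimes> a, v \<otimes> b}) < card (generate G {a, b})"
      using KL unfolding K_def H_def by (simp add: psubset_card_mono)
    then obtain ts where ts: "path_on {v \<otimes> a, v \<otimes> b} L ts"
      using less.hyps[of "v \<otimes> a" "v \<otimes> b"] vv a b KL unfolding K_def by auto
    \<comment> \<open>The prefixes of \<open>v\<close>; the last one, \<open>v\<close> itself, may differ from \<open>a\<^sup>m\<^sup>-\<^sup>1\<close> by a factor in \<open>L\<close>.\<close>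
    define q where "q j = (if j < Suc k then a [^] j else v)" for j :: nat
    have q: "\<exists>l\<in>L. q j = a [^] j \<otimes> l" if "j < m" for j
    proof (cases "j = Suc k")
      case True
      then show ?thesis using vv by (simp add: q_def)
    next
      case False
      then have "q j = a [^] j \<otimes> \<one>" using that a k by (simp add: q_def)
      then show ?thesis using subgroup.one_closed[OF Lsub] by blast
    qed
    have qc: "q j \<in> carrier G" for j using a vv by (simp add: q_def)
    have q_inj: "i = j \<and> t = t'"
      if *: "i < m" "j < m" "t \<in> L" "t' \<in> L" "t \<otimes> q i = t' \<otimes> q j" for i j t t'
    proof -
      have coset: "\<exists>l\<in>L. s \<otimes> q j = a [^] j \<otimes> l" if j: "j < m" and s: "s \<in> L" for j s
      proof -
        obtain l where l: "l \<in> L" "q j = a [^] j \<otimes> l" using q[OF j] by blast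
        have c: "l \<in> carrier G" "s \<in> carrier G" using l s Lc by auto
        have "s \<otimes> q j = a [^] j \<otimes> ((inv (a [^] j) \<otimes> s \<otimes> a [^] j) \<otimes> l)"
          unfolding l using c a by (simp add: word_simps)
        moreover have "(inv (a [^] j) \<otimes> s \<otimes> a [^] j) \<otimes> l \<in> L"
          using conj_power_closed[OF Lc a conj_a] s l Lsub by (simp add: subgroup.m_closed)
        ultimately show ?thesis by blast
      qed
      have "i = j" using coset[of i t] coset[of j t'] * m(4) by metis
      moreover have "t \<in> carrier G" "t' \<in> carrier G" using * Lc by auto
      ultimately show ?thesis using * qc by simp
    qed
    define p where "p = map q [0..<m]"
    have p_eq: "p = map (\<lambda>j. a [^] j) [0..<Suc k] @ [v]" unfolding p_def k by (simp add: q_def)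
    have p: "path_on {a, b} (q ` {..<m}) p"
      unfolding path_on_def
    proof (intro conjI)
      show "p \<noteq> []" using m(1) by (simp add: p_def)
      show "hd p = \<one>" using m(1) by (simp add: p_def hd_map q_def)
      show "set p = q ` {..<m}" by (auto simp: p_def)
      show "distinct p"
        unfolding p_def distinct_map
        using q_inj[of _ _ \<one> \<one>] qc subgroup.one_closed[OF Lsub] by (auto simp: inj_on_def)
      show "successively (\<lambda>x y. \<exists>s\<in>{a, b}. y = x \<otimes> s) p"
        unfolding p_eq successively_append_iff
        using vv by (auto simp: successively_conv_nth last_map simp del: upt_Suc)
    qed
    have "path_on {a, b} (L <#> q ` {..<m}) (map (\<lambda>(t, h). t \<otimes> h) (List.product ts p))"
    proof (rule path_on_product[OF p])
      have "last p = v" by (simp add: p_eq)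
      then show "path_on ((\<otimes>) (last p) ` {a, b}) L ts" using ts by simp
      show "inj_on (\<lambda>(t, h). t \<otimes> h) (L \<times> q ` {..<m})"
        using q_inj by (auto simp: inj_on_def) 
    qed (use a b Lc qc in auto)
    moreover have "L <#> q ` {..<m} = H"
    proof
      have "q j \<in> H" for j
      proof -
        obtain s where "s \<in> {a, b}" "v = a [^] k \<otimes> s" using vv by blast
        then have "v \<in> H" using abH Hsub by (auto simp: subgroup.m_closed subgroup_powI)
        then show ?thesis using abH Hsub by (simp add: q_def subgroup_powI)
      qed
      then show "L <#> q ` {..<m} \<subseteq> H"
        using LH Hsub by (auto simp: set_mult_def intro!: subgroup.m_closed)
      show "H \<subseteq> L <#> q ` {..<m}"
      proof
        fix h assume "h \<in> H"
        then obtain j n where jn: "j < m" "n \<in> L" "h = a [^] j \<otimes> n"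
          unfolding H_eq m(3) by (auto simp: set_mult_def)
        obtain l where l: "l \<in> L" "q j = a [^] j \<otimes> l" using q[OF jn(1)] by blast
        have c: "n \<in> carrier G" "l \<in> carrier G" using jn l Lc by auto
        define t where "t = a [^] j \<otimes> (n \<otimes> inv l) \<otimes> inv (a [^] j)"
        have nl: "n \<otimes> inv l \<in> L" using jn l Lsub by (simp add: subgroup.m_closed subgroup.m_inv_closed)
        have "inv (inv a [^] j) \<otimes> (n \<otimes> inv l) \<otimes> inv a [^] j \<in> L"
          by (rule conj_power_closed[OF Lc _ _ nl]) (use a conj_inv_closed[OF Lc a conj_a] in auto)
        then have "t \<in> L" unfolding t_def using a by (simp add: nat_pow_inv)
        moreover have "h = t \<otimes> q j" unfolding t_def l jn using a c by (simp add: word_simps)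
        ultimately show "h \<in> L <#> q ` {..<m}" using jn unfolding set_mult_def by blast
      qed
    qed
    ultimately show ?thesis unfolding H_def by auto
  qed
qed

lemma chain_has_generator:
  assumes "finite X" "X \<noteq> {}" "X \<subseteq> C"
  shows "\<exists>x\<in>X. X \<subseteq> generate G {x}"
  using assms
proof (induction X rule: finite_ne_induct)
  case (singleton x)
  then show ?case by (simp add: generate.incl)
next
  case (insert x X)
  then obtain y where y: "y \<in> X" "X \<subseteq> generate G {y}" by auto
  have sub: "subgroup (generate G {z}) G" if "z \<in> C" for z
    using C_carrier[OF that] by (intro generate_is_subgroup) auto
  have mem: "z \<in> generate G {z}" for z by (rule generate.incl) simp
  from chain[of x y] y insert.prems consider "x \<in> generate G {y}" | "y \<in> generate G {x}" by auto
  then show ?case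
  proof cases
    case 1
    then show ?thesis using y by auto
  next
    case 2
    then have "generate G {y} \<subseteq> generate G {x}"
      using generate_singleton_subset[OF sub] insert.prems by simp
    then show ?thesis using y(2) mem by blast
  qed
qed

text \<open>
  Modulo \<open>N\<close>, which is normal as a subgroup of \<open>C\<close>, the generators commute, so the quotient is abelian.
  The identity \<open>[kl, t] = k[l, t]k\<^sup>-\<^sup>1 \<cdot> [k, t]\<close> carries this from generators to all elements in one
  argument, and inverting the commutator exchanges the arguments.
\<close>

lemma commutators_in_subgroup:
  assumes N: "subgroup N G" "N \<subseteq> C" and S: "S \<subseteq> carrier G" and gen: "generate G S = carrier G"
    and comm: "\<And>s t. s \<in> S \<Longrightarrow> t \<in> S \<Longrightarrow> s \<otimes> t \<otimes> inv s \<otimes> inv t \<in> N"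
    and g: "g \<in> carrier G" and h: "h \<in> carrier G"
  shows "g \<otimes> h \<otimes> inv g \<otimes> inv h \<in> N"
proof -
  have Nc: "N \<subseteq> carrier G" using N subgroup.subset by blast
  have left: "k \<otimes> t \<otimes> inv k \<otimes> inv t \<in> N"
    if t: "t \<in> carrier G" and st: "\<And>s. s \<in> S \<Longrightarrow> s \<otimes> t \<otimes> inv s \<otimes> inv t \<in> N"
      and k: "k \<in> generate G S" for k t
    using k
  proof (induction k rule: generate.induct)
    case one
    then show ?case using t N by (simp add: subgroup.one_closed)
  next
    case (incl s)
    then show ?case by (rule st)
  next
    case (inv s)
    then have sc: "s \<in> carrier G" using S by auto
    have "inv s \<otimes> inv (s \<otimes> t \<otimes> inv s \<otimes> inv t) \<otimes> s \<in> N"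
      using conj_closed[OF N sc] st[OF inv] N by (simp add: subgroup.m_inv_closed)
    moreover have "inv s \<otimes> inv (s \<otimes> t \<otimes> inv s \<otimes> inv t) \<otimes> s = inv s \<otimes> t \<otimes> inv (inv s) \<otimes> inv t"
      using sc t by (simp add: word_simps)
    ultimately show ?case by simp
  next
    case (eng k l)
    have c: "k \<in> carrier G" "l \<in> carrier G" using eng S generate_in_carrier by auto
    have "inv (inv k) \<otimes> (l \<otimes> t \<otimes> inv l \<otimes> inv t) \<otimes> inv k \<in> N"
      using conj_closed[OF N, of "inv k"] eng c by simp
    then have "(inv (inv k) \<otimes> (l \<otimes> t \<otimes> inv l \<otimes> inv t) \<otimes> inv k) \<otimes> (k \<otimes> t \<otimes> inv k \<otimes> inv t) \<in> N"
      using eng N by (simp add: subgroup.m_closed)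
    moreover have "(inv (inv k) \<otimes> (l \<otimes> t \<otimes> inv l \<otimes> inv t) \<otimes> inv k) \<otimes> (k \<otimes> t \<otimes> inv k \<otimes> inv t)
        = k \<otimes> l \<otimes> t \<otimes> inv (k \<otimes> l) \<otimes> inv t"
      using c t by (simp add: word_simps)
    ultimately show ?case by simp
  qed
  have swap: "s \<otimes> k \<otimes> inv s \<otimes> inv k \<in> N"
    if "k \<otimes> s \<otimes> inv k \<otimes> inv s \<in> N" "s \<in> carrier G" "k \<in> carrier G" for s k
  proof -
    have "inv (k \<otimes> s \<otimes> inv k \<otimes> inv s) \<in> N" using that N by (simp add: subgroup.m_inv_closed)
    then show ?thesis using that by (simp add: word_simps)
  qed
  have "h \<otimes> s \<otimes> inv h \<otimes> inv s \<in> N" if "s \<in> S" for s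
    using left[of s h] comm that S gen h by auto
  then have "s \<otimes> h \<otimes> inv s \<otimes> inv h \<in> N" if "s \<in> S" for s
    using swap[of h s] that S h by auto
  then show ?thesis using left[of h g] gen g h by auto
qed

text \<open>
  Containing all commutators makes \<open>N\<close> normal. The element \<open>u = last p \<cdot> s\<close> lies in the coset \<open>Ns\<close>, so
  its powers reach the same cosets of \<open>N\<close> as those of \<open>s\<close>.
\<close>

lemma path_on_extend:
  assumes N: "subgroup N G"
    and comm: "\<And>g h. g \<in> carrier G \<Longrightarrow> h \<in> carrier G \<Longrightarrow> g \<otimes> h \<otimes> inv g \<otimes> inv h \<in> N"
    and p: "path_on S N p" and s: "s \<in> S" and S: "S \<subseteq> carrier G"
  shows "\<exists>M q. subgroup M G \<and> insert s N \<subseteq> M \<and> path_on S M q"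
proof -
  define u where "u = last p \<otimes> s"
  have Nc: "N \<subseteq> carrier G" using N by (rule subgroup.subset)
  have l: "last p \<in> N" using p by (auto simp: path_on_def)
  have c: "last p \<in> carrier G" "s \<in> carrier G" using l Nc s S by auto
  have u: "u \<in> carrier G" using c by (simp add: u_def)
  have norm: "inv u \<otimes> n \<otimes> u \<in> N" if n: "n \<in> N" for n
  proof -
    have nc: "n \<in> carrier G" using n Nc by auto
    have "(inv u \<otimes> n \<otimes> inv (inv u) \<otimes> inv n) \<otimes> n \<in> N"
      using comm[of "inv u" n] u nc n N by (simp add: subgroup.m_closed)
    moreover have "(inv u \<otimes> n \<otimes> inv (inv u) \<otimes> inv n) \<otimes> n = inv u \<otimes> n \<otimes> u"
      using u nc by (simp add: word_simps)
    ultimately show ?thesis by simp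
  qed
  let ?M = "generate G (insert u N)"
  have M: "subgroup ?M G" by (rule generate_is_subgroup) (use u Nc in auto)
  have mem: "u \<in> ?M" "N \<subseteq> ?M" by (auto intro: generate.incl)
  then have "inv (last p) \<otimes> u \<in> ?M"
    using M l by (auto intro!: subgroup.m_closed subgroup.m_inv_closed)
  moreover have "inv (last p) \<otimes> u = s" unfolding u_def using c by (simp add: word_simps)
  ultimately have "insert s N \<subseteq> ?M" using mem by auto
  moreover obtain q where "path_on S (power_cosets u N) q"
    using path_on_power_cosets[OF N p s S] unfolding u_def by blast
  ultimately show ?thesis using M generate_insert_normalized[OF N u norm] by auto
qed

theorem path_on_carrier:
  assumes S: "S \<subseteq> carrier G" and gen: "generate G S = carrier G"
  shows "\<exists>p. path_on S (carrier G) p"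
proof (cases "S = {}")
  case True
  then have "carrier G = {\<one>}" using gen generate_empty by simp
  then have "path_on S (carrier G) [\<one>]" by (simp add: path_on_def)
  then show ?thesis by blast
next
  case False
  have finS: "finite S" using S finite_carrier finite_subset by blast
  define X where "X = (\<lambda>(s, t). s \<otimes> t \<otimes> inv s \<otimes> inv t) ` (S \<times> S)"
  have "finite X" "X \<noteq> {}" "X \<subseteq> C"
    using finS False commutator_in_C S by (auto simp: X_def)
  then obtain x where x: "x \<in> X" "X \<subseteq> generate G {x}" using chain_has_generator by blast
  then obtain a b where ab: "a \<in> S" "b \<in> S" "x = a \<otimes> b \<otimes> inv a \<otimes> inv b" by (auto simp: X_def)
  have abc: "a \<in> carrier G" "b \<in> carrier G" using ab S by auto
  have xC: "x \<in> C" using x \<open>X \<subseteq> C\<close> by auto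
  have Zsub: "subgroup (generate G {x}) G"
    using C_carrier[OF xC] by (intro generate_is_subgroup) auto
  let ?H = "generate G {a, b}"
  have H: "subgroup ?H G" using abc by (intro generate_is_subgroup) auto
  have abH: "a \<in> ?H" "b \<in> ?H" by (auto intro: generate.incl)
  then have "x \<in> ?H" unfolding ab using H by (simp add: subgroup.m_closed subgroup.m_inv_closed)
  then have "generate G {x} \<subseteq> ?H" using generate_singleton_subset[OF H] by simp
  moreover have "g \<otimes> h \<otimes> inv g \<otimes> inv h \<in> generate G {x}"
    if "g \<in> carrier G" "h \<in> carrier G" for g h
    by (rule commutators_in_subgroup[OF Zsub _ S gen _ that])
      (use generate_singleton_subset[OF subgroup_C xC] x(2) in \<open>auto simp: X_def\<close>)
  ultimately have comm: "g \<otimes> h \<otimes> inv g \<otimes> inv h \<in> ?H"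
    if "g \<in> carrier G" "h \<in> carrier G" for g h using that by auto
  have "\<exists>M p. subgroup M G \<and> ?H \<subseteq> M \<and> T \<subseteq> M \<and> path_on S M p" if "finite T" "T \<subseteq> S" for T
    using that
  proof (induction T rule: finite_induct)
    case empty
    obtain p where "path_on {a, b} ?H p" using path_on_generate_pair[OF abc] by blast
    then have "path_on S ?H p" by (rule path_on_mono) (use ab in auto)
    then show ?case using H by auto
  next
    case (insert s T)
    then obtain M p where M: "subgroup M G" "?H \<subseteq> M" "T \<subseteq> M" "path_on S M p" by auto
    then have "\<And>g h. g \<in> carrier G \<Longrightarrow> h \<in> carrier G \<Longrightarrow> g \<otimes> h \<otimes> inv g \<otimes> inv h \<in> M"
      using comm by blast
    from path_on_extend[OF M(1) this M(4) _ S, of s] insert.prems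
    obtain M' q where "subgroup M' G" "insert s M \<subseteq> M'" "path_on S M' q" by auto
    then show ?case using M by (intro exI[of _ M'] exI[of _ q]) auto
  qed
  from this[OF finS] obtain M p where M: "subgroup M G" "S \<subseteq> M" "path_on S M p" by auto
  then have "M = carrier G"
    using gen generate_subgroup_incl subgroup.subset by (metis subset_antisym)
  then show ?thesis using M by auto
qed

end

section \<open>Cyclic commutator subgroups of order at most four\<close>

context finite_group
begin

lemma cyclic_group_card_le_3:
  assumes "card (carrier G) \<le> 3"
  shows "cyclic_group G"
proof (cases "carrier G = {\<one>}")
  case True
  then show ?thesis by (intro trivial_imp_cyclic_group) (simp add: trivial_group_def)
next
  case False
  then obtain c where c: "c \<in> carrier G" "c \<noteq> \<one>" by blast
  have "ord c dvd card (carrier G)" using ord_dvd_group_order[OF c(1)] by (simp add: order_def)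
  moreover have "ord c \<noteq> 1" using c ord_eq_1 by simp
  moreover have "card (carrier G) \<in> {1, 2, 3}"
  proof -
    have "card (carrier G) \<noteq> 0" using finite_carrier c by auto
    then show ?thesis using assms by auto
  qed
  ultimately have "ord c = card (carrier G)"
  proof -
    assume *: "ord c dvd card (carrier G)" "ord c \<noteq> 1" "card (carrier G) \<in> {1, 2, 3}"
    then have "ord c \<le> 3" by (auto dest: dvd_imp_le)
    moreover have "ord c \<noteq> 0" by (rule notI) (use * in auto)
    ultimately have "ord c = 2 \<or> ord c = 3" using *(2) by arith
    with *(1,3) show ?thesis by auto
  qed
  then have "generate G {c} = carrier G"
    using generate_pow_card[OF c(1)] generate_incl[of "{c}"] c finite_carrier
    by (metis card_subset_eq empty_subsetI insert_subset)
  then have "carrier G = range (\<lambda>n::int. c [^] n)"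
    using generate_pow[OF c(1)] by (simp add: full_SetCompr_eq)
  then show ?thesis using c(1) unfolding cyclic_group by blast
qed

lemma cyclic_subgroup_generator:
  assumes C: "subgroup C G" and cyc: "cyclic_group (G\<lparr>carrier := C\<rparr>)"
  obtains c where "c \<in> C" "C = generate G {c}"
proof -
  interpret K: group "G\<lparr>carrier := C\<rparr>" by (rule subgroup_imp_group[OF C])
  from cyc obtain c where c: "c \<in> C" "C = range (\<lambda>n::int. c [^]\<^bsub>G\<lparr>carrier := C\<rparr>\<^esub> n)"
    by (auto simp: K.cyclic_group)
  have "c [^]\<^bsub>G\<lparr>carrier := C\<rparr>\<^esub> n = c [^] n" for n :: int
    using int_pow_consistent[OF C c(1)] by simp
  then have "C = generate G {c}"
    using c generate_pow[of c] subgroup.subset[OF C] by auto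
  then show thesis using that c by blast
qed

text \<open>
  Let \<open>n\<close> be the order of a generator. Among the exponents below \<open>n \<le> 4\<close> at most \<open>0\<close>, and \<open>2\<close> if
  \<open>n = 4\<close>, differ from both \<open>1\<close> and \<open>n - 1\<close>. The corresponding powers have order less than \<open>n\<close>, so conjugation sends the generator to
  itself or to its inverse.
\<close>

lemma inverted_chain_cyclic_le_4:
  assumes C: "subgroup C G" and cyc: "cyclic_group (G\<lparr>carrier := C\<rparr>)" and card: "card C \<le> 4"
    and comm: "\<And>x y. x \<in> carrier G \<Longrightarrow> y \<in> carrier G \<Longrightarrow> x \<otimes> y \<otimes> inv x \<otimes> inv y \<in> C"
  shows "inverted_chain G C"
proof -
  obtain c where cC: "c \<in> C" "C = generate G {c}" using cyclic_subgroup_generator[OF C cyc] .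
  have c: "c \<in> carrier G" using cC subgroup.subset[OF C] by auto
  define n where "n = ord c"
  have n: "0 < n" "n \<le> 4"
    using ord_ge_1[OF finite_carrier c] card generate_pow_card[OF c] cC by (auto simp: n_def)
  have cn: "c [^] n = \<one>" using c by (simp add: n_def)
  have mod: "c [^] (k mod n) = c [^] k" for k
  proof -
    have "c [^] k = c [^] (n * (k div n)) \<otimes> c [^] (k mod n)"
      using c by (simp add: nat_pow_mult)
    also have "c [^] (n * (k div n)) = \<one>" using c cn by (simp flip: nat_pow_pow)
    finally show ?thesis using c by simp
  qed
  have power: "\<exists>k<n. x = c [^] k" if x: "x \<in> C" for x
  proof -
    obtain k :: nat where "x = c [^] k" using x cC c by (auto simp: mem_generate_singleton)
    then show ?thesis using mod[of k] n by (intro exI[of _ "k mod n"]) auto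
  qed
  show ?thesis
  proof (intro inverted_chain.intro inverted_chain_axioms.intro)
    show "finite_group G" by (rule finite_group_axioms)
    show "subgroup C G" by (rule C)
    show "x \<otimes> y \<otimes> inv x \<otimes> inv y \<in> C" if "x \<in> carrier G" "y \<in> carrier G" for x y
      using comm that .
    show "x \<in> generate G {y} \<or> y \<in> generate G {x}" if xy: "x \<in> C" "y \<in> C" for x y
    proof -
      obtain i j where ij: "i < n" "j < n" "x = c [^] i" "y = c [^] j" using power xy by blast
      have "i = 0 \<or> j = 0 \<or> i = 1 \<or> j = 1 \<or> i = j \<or> n = 4 \<and> i = 2 \<and> j = 3 \<or> n = 4 \<and> i = 3 \<and> j = 2"
        using ij(1,2) n by arith
      then have "(\<exists>k. i = j * k mod n) \<or> (\<exists>k. j = i * k mod n)"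
      proof (elim disjE conjE)
        assume "i = 0" then have "i = j * 0 mod n" by simp
        then show ?thesis by blast
      next
        assume "j = 0" then have "j = i * 0 mod n" by simp
        then show ?thesis by blast
      next
        assume "i = 1" then have "j = i * j mod n" using ij by simp
        then show ?thesis by blast
      next
        assume "j = 1" then have "i = j * i mod n" using ij by simp
        then show ?thesis by blast
      next
        assume "i = j" then have "i = j * 1 mod n" using ij by simp
        then show ?thesis by blast
      next
        assume "n = 4" "i = 2" "j = 3" then have "i = j * 2 mod n" by simp
        then show ?thesis by blast
      next
        assume "n = 4" "i = 3" "j = 2" then have "j = i * 2 mod n" by simp
        then show ?thesis by blast
      qed
      then have "(\<exists>k::nat. x = y [^] k) \<or> (\<exists>k::nat. y = x [^] k)"
        unfolding ij(3,4) nat_pow_pow[OF c] using mod by metis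
      then show ?thesis using ij c by (auto simp: mem_generate_singleton)
    qed
    show "(\<forall>x\<in>C. inv g \<otimes> x \<otimes> g = x) \<or> (\<forall>x\<in>C. inv g \<otimes> x \<otimes> g = inv x)"
      if g: "g \<in> carrier G" for g
    proof -
      define d where "d = inv g \<otimes> c \<otimes> g"
      have conj_pow: "inv g \<otimes> c [^] k \<otimes> g = d [^] k" for k :: nat
      proof (induction k)
        case (Suc k)
        have "inv g \<otimes> c [^] Suc k \<otimes> g = (inv g \<otimes> c [^] k \<otimes> g) \<otimes> d"
          unfolding d_def using g c by (simp add: word_simps)
        then show ?case using Suc by simp
      qed (use g in simp)
      have "d \<in> C"
      proof -
        have "(inv g \<otimes> c \<otimes> inv (inv g) \<otimes> inv c) \<otimes> c \<in> C"
          using comm[of "inv g" c] g c cC(1) C by (simp add: subgroup.m_closed)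
        moreover have "(inv g \<otimes> c \<otimes> inv (inv g) \<otimes> inv c) \<otimes> c = d"
          unfolding d_def using g c by (simp add: word_simps)
        ultimately show ?thesis by simp
      qed
      then obtain j where j: "j < n" "d = c [^] j" using power by blast
      have inv_c: "c [^] (n - 1) = inv c" using power_pred_ord_eq_inv[OF c] by (simp add: n_def)
      have conj_eq_one: "x = \<one>" if "x \<in> carrier G" "inv g \<otimes> x \<otimes> g = \<one>" for x
      proof -
        have "g \<otimes> (inv g \<otimes> x \<otimes> g) \<otimes> inv g = x" using that(1) g by (simp add: word_simps)
        then show ?thesis using that g by simp
      qed
      have "j = 0 \<or> j = 1 \<or> j = n - 1 \<or> n = 4 \<and> j = 2" using j(1) n by arith
      then have "d = c \<or> d = inv c"
      proof (elim disjE conjE)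
        assume "j = 0"
        then show ?thesis using j conj_eq_one[OF c] by (simp add: d_def)
      next
        assume "j = 1"
        then show ?thesis using j c by simp
      next
        assume "j = n - 1"
        then show ?thesis using j inv_c by simp
      next
        assume *: "n = 4" "j = 2"
        have "inv g \<otimes> c [^] (2::nat) \<otimes> g = \<one>"
          unfolding conj_pow j(2) using * c cn by (simp add: nat_pow_pow)
        then have "c [^] (2::nat) = \<one>" using conj_eq_one c by simp
        then have "d = \<one>" using j * by simp
        then show ?thesis using conj_eq_one[OF c] by (simp add: d_def)
      qed
      then show ?thesis
      proof
        assume "d = c"
        then show ?thesis using conj_pow power by blast
      next
        assume "d = inv c"
        then have "inv g \<otimes> c [^] k \<otimes> g = inv (c [^] k)" for k :: nat
          using conj_pow c by (simp add: nat_pow_inv)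
        then show ?thesis using power by blast
      qed
    qed
  qed
qed

lemma hamiltonian_path_if_path_on:
  assumes p: "path_on S (carrier G) p" and S: "S \<subseteq> carrier G"
  shows "hamiltonian_path p (with_proj (cayley_digraph G S))"
proof -
  let ?D = "cayley_digraph G S"
  have arcs: "set (vwalk_arcs q) \<subseteq> parcs ?D"
    if "set q \<subseteq> carrier G" "successively (\<lambda>x y. \<exists>s\<in>S. y = x \<otimes> s) q" for q
    using that by (induction q rule: vwalk_arcs.induct) (auto simp: cayley_digraph_def)
  have ends: "arcs_ends (with_proj ?D) = parcs ?D"
    by (auto simp: arcs_ends_def arc_to_ends_def)
  have "vpath p (with_proj ?D)"
    unfolding vpath_def vwalk_def ends
    using p arcs[of p] by (auto simp: path_on_def cayley_digraph_def)
  then show ?thesis using p by (simp add: hamiltonian_path_def path_on_def cayley_digraph_def)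
qed

end

lemma cyclic_integer_mod_group:
  "cyclic_group (integer_mod_group n)"
proof -
  interpret Z: group "integer_mod_group n" by simp
  have "range (\<lambda>k::int. (1 mod int n) [^]\<^bsub>integer_mod_group n\<^esub> k) = range (\<lambda>k. k mod int n)"
    by (simp add: int_pow_integer_mod_group mod_mult_right_eq)
  also have "\<dots> = carrier (integer_mod_group n)"
  proof (cases "n = 0")
    case False
    then have "k \<in> range (\<lambda>k. k mod int n)" if "0 \<le> k" "k < int n" for k
      using that by (intro range_eqI[of _ _ k]) simp
    then show ?thesis using False by (auto simp: carrier_integer_mod_group)
  qed (simp add: carrier_integer_mod_group)
  moreover have "1 mod int n \<in> carrier (integer_mod_group n)"
    by (auto simp: carrier_integer_mod_group)
  ultimately show ?thesis unfolding Z.cyclic_group by metis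
qed

theorem corollary4p7:
  fixes G :: "('a, 'b) monoid_scheme" and S :: "'a set"
  assumes "group G" and "finite (carrier G)"
    and "card (commutator_subgroup G) \<le> 3 \<or>
         G\<lparr>carrier := commutator_subgroup G\<rparr> \<cong> integer_mod_group 4"
    and "S \<subseteq> carrier G" and "generate G S = carrier G"
  shows "\<exists>p. hamiltonian_path p (with_proj (cayley_digraph G S))"
proof -
  interpret finite_group G
    using assms by (simp add: finite_group_def finite_group_axioms_def)
  let ?C = "commutator_subgroup G"
  have C: "subgroup ?C G" by (rule derived_is_subgroup) simp
  interpret K: group "G\<lparr>carrier := ?C\<rparr>" by (rule subgroup_imp_group[OF C])
  have finC: "finite ?C" using finite_subset[OF subgroup.subset[OF C] finite_carrier] .
  have "cyclic_group (G\<lparr>carrier := ?C\<rparr>) \<and> card ?C \<le> 4"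
    using assms(3)
  proof
    assume card: "card ?C \<le> 3"
    interpret K: finite_group "G\<lparr>carrier := ?C\<rparr>" by unfold_locales (simp add: finC)
    show ?thesis using K.cyclic_group_card_le_3 card by simp
  next
    assume iso: "G\<lparr>carrier := ?C\<rparr> \<cong> integer_mod_group 4"
    have "card ?C = 4" using iso_same_card[OF iso] by (simp add: carrier_integer_mod_group)
    moreover have "cyclic_group (G\<lparr>carrier := ?C\<rparr>)"
      using isomorphic_group_cyclicity[OF iso K.is_group] cyclic_integer_mod_group by simp
    ultimately show ?thesis by simp
  qed
  moreover have "x \<otimes>\<^bsub>G\<^esub> y \<otimes>\<^bsub>G\<^esub> inv\<^bsub>G\<^esub> x \<otimes>\<^bsub>G\<^esub> inv\<^bsub>G\<^esub> y \<in> ?C" if "x \<in> carrier G" "y \<in> carrier G" for x y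
    unfolding derived_def using that by (intro generate.incl) auto
  ultimately interpret inverted_chain G ?C
    using inverted_chain_cyclic_le_4[OF C] by blast
  show ?thesis
    using path_on_carrier[OF assms(4,5)] hamiltonian_path_if_path_on[OF _ assms(4)] by blast
qed

end
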